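(* Let $0\le \underline{k}\le\overline{k}$ be integers. As formal Laurent series in $x$ with coefficients in $\mathbb{Z}[y]$, $$W_{\underline{k}\le\overline{k}}(x,y)=\sum_{n,m}w_{\underline{k}\le\overline{k}}(n,m)x^ny^m=\frac{1-x}{x\big(1-2x+(1-y)(x^{\underline{k}+1}-x^{\overline{k}+2})\big)},$$ and consequently, for every $m\ge 0$, $$[y^m]W_{\underline{k}\le\overline{k}}(x,y)=\frac{(1-x)\big(x^{\underline{k}+1}-x^{\overline{k}+2}\big)^m}{x\big(1-2x+x^{\underline{k}+1}-x^{\overline{k}+2}\big)^{m+1}}.$$
   Context: An $n$-string is a binary string of length $n$. A run of ones is a maximal block of consecutive ones, flanked on each side by a zero or by the start/end of the string. Null runs (length $0$) of ones also count: there is one between every two consecutive zeros, one before an initial zero and one after a final zero; thus a string with $z$ zeros has exactly $z+1$ runs of ones (including null ones), namely the possibly empty blocks of ones delimited by the zeros; the empty string has one null run. For $n\ge 0$, $w_{\underline{k}\le\overline{k}}(n,m)$ is the number of $n$-strings containing exactly $m$ runs of ones whose length lies in $[\underline{k},\overline{k}]$ (null runs included if $\underline{k}=0$; other runs are unrestricted). By convention $w_{\underline{k}\le\overline{k}}(-1,m)=1$ if $m=0$ and $0$ otherwise, and $w_{\underline{k}\le\overline{k}}(n,m)=0$ if $n<-1$ or $m<0$. The sum is over all integers $n,m$. *)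

theory Defs
  imports
    "HOL-Computational_Algebra.Polynomial"
    "HOL-Computational_Algebra.Formal_Laurent_Series"
begin

text \<open>
  A binary string is a \<open>bool list\<close> with \<open>True\<close> for one and \<open>False\<close> for zero. A run of ones
  is encoded by its start \<open>i\<close> and its (exclusive) end \<open>j\<close>. The case \<open>i = j\<close> is a null run:
  the two flanking conditions then say exactly that it lies between two consecutive zeros,
  before an initial zero, after a final zero, or in the empty string.
\<close>

definition runs_of_ones :: "bool list \<Rightarrow> (nat \<times> nat) set" where
  "runs_of_ones s =
     {(i, j). i \<le> j \<and> j \<le> length s \<and> (\<forall>t\<in>{i..<j}. s ! t) \<and>
              (i = 0 \<or> \<not> s ! (i - 1)) \<and> (j = length s \<or> \<not> s ! j)}"

definition num_runs :: "nat \<Rightarrow> nat \<Rightarrow> bool list \<Rightarrow> nat" where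
  "num_runs kl ku s = card {(i, j) \<in> runs_of_ones s. kl \<le> j - i \<and> j - i \<le> ku}"

definition w :: "nat \<Rightarrow> nat \<Rightarrow> int \<Rightarrow> int \<Rightarrow> nat" where
  "w kl ku n m =
     (if n < -1 \<or> m < 0 then 0
      else if n = -1 then (if m = 0 then 1 else 0)
      else card {s :: bool list. int (length s) = n \<and> int (num_runs kl ku s) = m})"

text \<open>
  The generating function as an element of \<open>\<int>[y]((x))\<close>. Terms with \<open>m < 0\<close> vanish by
  convention, and \<open>coeff_W\<close> below shows that the coefficients are not affected by the
  two type-constructor abstractions.
\<close>

definition W :: "nat \<Rightarrow> nat \<Rightarrow> int poly fls" where
  "W kl ku = Abs_fls (\<lambda>n. Abs_poly (\<lambda>m. int (w kl ku n (int m))))"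

definition y_coeff :: "nat \<Rightarrow> 'a::zero poly fls \<Rightarrow> 'a fls" where
  "y_coeff m F = Abs_fls (\<lambda>n. coeff (fls_nth F n) m)"

text \<open>
  The library's division on \<open>fls\<close> needs an inverse operation on the coefficients, which
  \<open>int\<close> and \<open>int poly\<close> do not have. This is the quotient \<open>a / b\<close> in a commutative ring,
  meaningful whenever \<open>b\<close> is a unit.
\<close>

definition unit_quotient :: "'a::comm_ring_1 \<Rightarrow> 'a \<Rightarrow> 'a"  (infixl "\<oslash>" 70) where
  "a \<oslash> b = (THE q. q * b = a)"

lemma unit_quotient_eq_iff:
  fixes a b q :: "'a::comm_ring_1"
  assumes "b dvd 1"
  shows "q = a \<oslash> b \<longleftrightarrow> q * b = a"
proof -
  from assms obtain c where c: "b * c = 1" by (metis dvdE)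
  have u: "r * b = a \<longleftrightarrow> r = a * c" for r
  proof
    assume "r * b = a"
    then have "a * c = r * (b * c)" by (simp flip: mult.assoc)
    then show "r = a * c" using c by simp
  next
    assume "r = a * c"
    then show "r * b = a" using c by (simp add: mult.assoc mult.commute[of c b])
  qed
  show ?thesis unfolding unit_quotient_def u by simp
qed

lemma nth_y_coeff: "fls_nth (y_coeff m F) n = coeff (fls_nth F n) m"
  unfolding y_coeff_def
  by (rule nth_Abs_fls_lower_bound[of "fls_subdegree F"]) simp

lemma num_runs_le: "num_runs kl ku s \<le> (length s + 1)\<^sup>2"
proof -
  have "{(i, j) \<in> runs_of_ones s. kl \<le> j - i \<and> j - i \<le> ku} \<subseteq> {..length s} \<times> {..length s}"
    by (auto simp: runs_of_ones_def)
  from card_mono[OF _ this] show ?thesis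
    by (simp add: num_runs_def power2_eq_square)
qed

lemma coeff_W: "coeff (fls_nth (W kl ku) n) m = int (w kl ku n (int m))"
proof -
  have "fls_nth (W kl ku) n = Abs_poly (\<lambda>m. int (w kl ku n (int m)))"
    unfolding W_def
    by (rule nth_Abs_fls_lower_bound[of "-1"]) (simp add: w_def zero_poly.abs_eq)
  moreover have "\<forall>\<^sub>\<infinity>m. int (w kl ku n (int m)) = 0"
  proof -
    have "int (w kl ku n (int m)) = 0" if m: "m > (nat n + 1)\<^sup>2" for m
    proof -
      have "m > 0" using m by simp
      moreover have "{s. int (length s) = n \<and> num_runs kl ku s = m} = {}"
        using num_runs_le[of kl ku] m by (force simp: not_less[symmetric])
      then have "card {s. int (length s) = n \<and> num_runs kl ku s = m} = 0"
        by (simp only: card.empty)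
      ultimately show ?thesis by (simp add: w_def)
    qed
    then show ?thesis by (auto simp: MOST_nat)
  qed
  ultimately show ?thesis by (simp add: Abs_poly_inverse)
qed

end

theory Submission
  imports Defs
begin

text \<open>
  Cut a string at its first zero: it is either \<open>1\<^sup>k\<close>, or \<open>1\<^sup>k 0 s\<close> with an arbitrary
  string \<open>s\<close>, and in both cases the leading block is one run of length \<open>k\<close> while the
  remaining runs are those of \<open>s\<close> (\<open>runs_of_ones_replicate\<close>, \<open>runs_of_ones_block\<close>).
  Let \<open>R\<close> be the series of a single run, \<open>R = \<Sum>k. c\<^sub>k x\<^sup>k\<close>, where \<open>c\<^sub>k\<close> is \<open>y\<close> for
  lengths in the given range and \<open>1\<close> otherwise, and let \<open>Q = x W\<close>. The conventional term
  of \<open>W\<close> at \<open>n = -1\<close> makes \<open>1\<close> the constant term of \<open>Q\<close>; it plays the part of the missing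
  tail of the string \<open>1\<^sup>k\<close>, so that both cases together say \<open>Q = 1 + x R Q\<close>
  (\<open>string_fps_run_fps\<close>).

  Since \<open>R\<close> differs from \<open>1 / (1 - x)\<close> only in the range, it satisfies
  \<open>(1 - x) R = 1 - (1 - y) (x\<^sup>a - x\<^sup>b)\<close> for the lower bound \<open>a\<close> and the successor \<open>b\<close>
  of the upper bound of the range. Multiplying the equation for \<open>Q\<close> by \<open>1 - x\<close> gives the
  first formula. For the second one, write the denominator as \<open>x (A - y B)\<close>, where \<open>A\<close> and
  \<open>B\<close> are free of \<open>y\<close>. Comparing coefficients of \<open>y\<^sup>m\<close> in \<open>W x (A - y B) = 1 - x\<close> gives a
  recurrence of first order for these coefficients, and induction on \<open>m\<close> solves it.
\<close>

section \<open>Splitting a string at its first zero\<close>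

lemma runs_of_ones_replicate: "runs_of_ones (replicate k True) = {(0, k)}"
proof -
  have "i = 0 \<and> j = k"
    if "i \<le> j" "j \<le> k" "i = 0 \<or> \<not> replicate k True ! (i - 1)"
      "j = k \<or> \<not> replicate k True ! j" for i j
    using that by (cases i; cases "j < k") auto
  then show ?thesis by (auto simp: runs_of_ones_def)
qed

lemma runs_of_ones_block:
  "runs_of_ones (replicate k True @ False # s) =
     insert (0, k) ((\<lambda>(i, j). (i + Suc k, j + Suc k)) ` runs_of_ones s)"
  (is "?L = insert _ (?sh ` _)")
proof -
  let ?u = "replicate k True @ False # s"
  have nth: "?u ! t \<longleftrightarrow> t < k \<or> t > k \<and> s ! (t - Suc k)" for t
  proof (cases "t \<le> k")
    case False
    then obtain r where "t = Suc (k + r)" by (metis less_imp_Suc_add not_le)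
    then show ?thesis by (simp add: nth_append)
  qed (auto simp: nth_append)
  show ?thesis
  proof (intro equalityI subsetI)
    fix p assume "p \<in> ?L"
    then obtain i j where p: "p = (i, j)" and le: "i \<le> j" "j \<le> Suc (k + length s)"
      and ones: "\<forall>t\<in>{i..<j}. ?u ! t"
      and start: "i = 0 \<or> \<not> ?u ! (i - 1)"
      and stop: "j = Suc (k + length s) \<or> \<not> ?u ! j"
      by (auto simp: runs_of_ones_def)
    show "p \<in> insert (0, k) (?sh ` runs_of_ones s)"
    proof (cases "i \<le> k")
      case True
      have i: "i = 0" using start True by (auto simp: nth)
      have "j \<le> k"
        using ones i nth[of k] by (metis atLeastLessThan_iff le0 less_irrefl not_le)
      moreover have "\<not> j < k" using stop by (auto simp: nth)
      ultimately show ?thesis using p i by simp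
    next
      case False
      define i' where "i' = i - Suc k"
      define j' where "j' = j - Suc k"
      have ij: "i = i' + Suc k" "j = j' + Suc k"
        using False le by (auto simp: i'_def j'_def)
      have "s ! t" if "i' \<le> t" "t < j'" for t
        using ones[rule_format, of "t + Suc k"] that by (simp add: ij nth)
      moreover have "i' = 0 \<or> \<not> s ! (i' - 1)"
        using start by (cases i') (auto simp: ij nth)
      moreover have "j' = length s \<or> \<not> s ! j'"
        using stop by (auto simp: ij nth)
      ultimately have "(i', j') \<in> runs_of_ones s"
        using le by (auto simp: runs_of_ones_def ij)
      then show ?thesis unfolding p ij by (intro insertI2 image_eqI) auto
    qed
  next
    fix p assume "p \<in> insert (0, k) (?sh ` runs_of_ones s)"
    then consider "p = (0, k)" | i j where "p = (i + Suc k, j + Suc k)" "(i, j) \<in> runs_of_ones s"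
      by auto
    then show "p \<in> ?L"
    proof cases
      case 1
      then show ?thesis by (auto simp: runs_of_ones_def nth)
    next
      case 2
      then have "?u ! t" if "i + Suc k \<le> t" "t < j + Suc k" for t
      proof -
        have "t - Suc k \<in> {i..<j}" using that by auto
        then show ?thesis using that 2 by (auto simp: runs_of_ones_def nth)
      qed
      then show ?thesis using 2
        by (cases i) (auto simp: runs_of_ones_def nth)
    qed
  qed
qed

lemma num_runs_replicate:
  "num_runs kl ku (replicate k True) = of_bool (kl \<le> k \<and> k \<le> ku)"
proof -
  have "{(i, j) \<in> runs_of_ones (replicate k True). kl \<le> j - i \<and> j - i \<le> ku} =
    (if kl \<le> k \<and> k \<le> ku then {(0, k)} else {})"
    by (auto simp: runs_of_ones_replicate)
  then show ?thesis by (simp add: num_runs_def)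
qed

lemma num_runs_block:
  "num_runs kl ku (replicate k True @ False # s) =
     of_bool (kl \<le> k \<and> k \<le> ku) + num_runs kl ku s"
proof -
  let ?sh = "\<lambda>(i, j). (i + Suc k, j + Suc k)"
  let ?S = "\<lambda>s. {(i, j) \<in> runs_of_ones s. kl \<le> j - i \<and> j - i \<le> ku}"
  have fin: "finite (?S s)"
    by (rule finite_subset[of _ "{..length s} \<times> {..length s}"]) (auto simp: runs_of_ones_def)
  have eq: "?S (replicate k True @ False # s) =
      (if kl \<le> k \<and> k \<le> ku then {(0, k)} else {}) \<union> ?sh ` ?S s"
    unfolding runs_of_ones_block by (auto simp: image_iff)
  have "card (?sh ` ?S s) = card (?S s)"
    by (rule card_image) (auto simp: inj_on_def)
  moreover have "(0, k) \<notin> ?sh ` ?S s" by auto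
  ultimately show ?thesis
    unfolding num_runs_def eq using fin by simp
qed

section \<open>The generating function as a power series\<close>

abbreviation strings :: "nat \<Rightarrow> bool list set" where
  "strings n \<equiv> {s. length s = n}"

lemma finite_strings: "finite (strings n)"
  using finite_lists_length_eq[of "UNIV :: bool set" n] by simp

lemma sum_strings_Suc:
  fixes f :: "bool list \<Rightarrow> 'a::comm_monoid_add"
  shows "(\<Sum>s\<in>strings (Suc n). f s) =
    (\<Sum>s\<in>strings n. f (True # s)) + (\<Sum>s\<in>strings n. f (False # s))"
proof -
  have "strings (Suc n) = (#) True ` strings n \<union> (#) False ` strings n"
    by (auto simp: length_Suc_conv image_iff)
  moreover have "(#) True ` strings n \<inter> (#) False ` strings n = {}" by auto
  ultimately show ?thesis
    by (simp add: sum.union_disjoint finite_strings sum.reindex)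
qed

definition run_weight :: "nat \<Rightarrow> nat \<Rightarrow> nat \<Rightarrow> int poly" where
  "run_weight kl ku k = [:0, 1:] ^ of_bool (kl \<le> k \<and> k \<le> ku)"

definition run_fps :: "nat \<Rightarrow> nat \<Rightarrow> int poly fps" where
  "run_fps kl ku = Abs_fps (run_weight kl ku)"

definition string_poly :: "nat \<Rightarrow> nat \<Rightarrow> nat \<Rightarrow> int poly" where
  "string_poly kl ku n = (\<Sum>s\<in>strings n. [:0, 1:] ^ num_runs kl ku s)"

text \<open>
  This is \<open>x W\<close>: the index is shifted by one, which turns the Laurent series with its
  conventional term at \<open>-1\<close> into a power series with constant term \<open>1\<close>.
\<close>

definition string_fps :: "nat \<Rightarrow> nat \<Rightarrow> int poly fps" where
  "string_fps kl ku =
     Abs_fps (\<lambda>n. case n of 0 \<Rightarrow> 1 | Suc n \<Rightarrow> string_poly kl ku n)"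

text \<open>
  The prefix of \<open>k\<close> ones makes the splitting at the first zero a plain induction on the
  length \<open>n\<close> of the rest: a leading one only lengthens the prefix, a leading zero closes
  the run. The summand \<open>j = n\<close>, with the factor \<open>1\<close>, belongs to the string without zeros.
\<close>

lemma sum_strings_prefix:
  "(\<Sum>s\<in>strings n. [:0, 1:] ^ num_runs kl ku (replicate k True @ s)) =
     (\<Sum>j\<le>n. run_weight kl ku (k + j) * fps_nth (string_fps kl ku) (n - j))"
proof (induction n arbitrary: k)
  case 0
  then show ?case
    by (simp add: string_fps_def run_weight_def num_runs_replicate)
next
  case (Suc n)
  have "(\<Sum>s\<in>strings (Suc n). [:0, 1:] ^ num_runs kl ku (replicate k True @ s)) =
      (\<Sum>s\<in>strings n. [:0, 1:] ^ num_runs kl ku (replicate (Suc k) True @ s)) +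
      run_weight kl ku k * string_poly kl ku n"
    unfolding sum_strings_Suc
    by (simp add: num_runs_block power_add run_weight_def string_poly_def
        sum_distrib_left replicate_app_Cons_same)
  also have "\<dots> = (\<Sum>j\<le>Suc n. run_weight kl ku (k + j) * fps_nth (string_fps kl ku) (Suc n - j))"
    unfolding Suc.IH sum.atMost_Suc_shift by (simp add: string_fps_def)
  finally show ?case .
qed

text \<open>
  The splitting with an empty prefix is a convolution, hence a product of power series; the
  factor \<open>x\<close> accounts for the zero that ends the first run and for the index shift.
\<close>

lemma string_fps_run_fps:
  "string_fps kl ku = 1 + fps_X * run_fps kl ku * string_fps kl ku"
proof (rule fps_ext)
  fix n
  show "fps_nth (string_fps kl ku) n =
      fps_nth (1 + fps_X * run_fps kl ku * string_fps kl ku) n"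
  proof (cases n)
    case 0
    then show ?thesis by (simp add: string_fps_def)
  next
    case (Suc l)
    have "fps_nth (string_fps kl ku) n = string_poly kl ku l"
      by (simp add: string_fps_def Suc)
    also have "\<dots> = fps_nth (run_fps kl ku * string_fps kl ku) l"
      using sum_strings_prefix[of kl ku 0 l]
      by (simp add: string_poly_def run_fps_def fps_mult_nth atLeast0AtMost)
    finally show ?thesis by (simp add: Suc mult.assoc)
  qed
qed

lemma fps_X_power_mult_geometric_nth:
  "fps_nth (fps_X ^ k * Abs_fps (\<lambda>_. 1 :: 'a::comm_ring_1)) n = of_bool (k \<le> n)"
  by (simp add: fps_X_power_mult_nth)

text \<open>
  Since \<open>kl \<le> ku\<close>, the indicator of the range is the difference of the indicators of the
  rays \<open>{kl..}\<close> and \<open>{ku + 1..}\<close>, and the series of a ray is a shifted geometric series.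
\<close>

lemma one_minus_X_mult_run_fps:
  assumes "kl \<le> ku"
  shows "(1 - fps_X) * run_fps kl ku =
    1 - (1 - fps_const [:0, 1:]) * (fps_X ^ kl - fps_X ^ (ku + 1))"
proof -
  let ?G = "Abs_fps (\<lambda>_. 1) :: int poly fps"
  have R: "run_fps kl ku = ?G - (1 - fps_const [:0, 1:]) * ((fps_X ^ kl - fps_X ^ (ku + 1)) * ?G)"
    using assms
    by (intro fps_ext)
      (simp add: run_fps_def run_weight_def left_diff_distrib fps_X_power_mult_geometric_nth
        del: power_Suc)
  have G: "(1 - fps_X) * ?G = 1"
    by (rule fps_ext) (simp add: left_diff_distrib)
  have "(1 - fps_X) * (?G - c * (d * ?G)) = 1 - c * d" for c d
  proof -
    have "(1 - fps_X) * (?G - c * (d * ?G)) = (1 - fps_X) * ?G - c * d * ((1 - fps_X) * ?G)"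
      by (simp only: right_diff_distrib mult_ac)
    then show ?thesis by (simp only: G mult_1_right)
  qed
  then show ?thesis unfolding R .
qed

text \<open>
  As a power series, without the factor \<open>x\<close>, the denominator has constant term \<open>1\<close> and is
  therefore a unit although the coefficient ring is not a field.
\<close>

definition denominator :: "nat \<Rightarrow> nat \<Rightarrow> int poly fps" where
  "denominator kl ku =
     1 - 2 * fps_X + (1 - fps_const [:0, 1:]) * (fps_X ^ (kl + 1) - fps_X ^ (ku + 2))"

lemma string_fps_mult_denominator:
  assumes "kl \<le> ku"
  shows "string_fps kl ku * denominator kl ku = 1 - fps_X"
proof -
  let ?Q = "string_fps kl ku" and ?R = "run_fps kl ku"
  have "denominator kl ku = (1 - fps_X) - fps_X *
      (1 - (1 - fps_const [:0, 1:]) * (fps_X ^ kl - fps_X ^ (ku + 1)))"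
    by (simp add: denominator_def algebra_simps)
  also have "\<dots> = (1 - fps_X) * (1 - fps_X * ?R)"
    unfolding one_minus_X_mult_run_fps[OF assms, symmetric] by (simp add: algebra_simps)
  finally have D: "denominator kl ku = (1 - fps_X) * (1 - fps_X * ?R)" .
  have "?Q * denominator kl ku = (1 - fps_X) * (?Q - fps_X * ?R * ?Q)"
    unfolding D by (simp add: algebra_simps)
  also have "?Q - fps_X * ?R * ?Q = 1"
    using string_fps_run_fps[of kl ku] by (metis add_diff_cancel_right')
  finally show ?thesis by simp
qed

lemma coeff_sum_monom_power:
  assumes "finite S"
  shows "coeff (\<Sum>s\<in>S. [:0, 1:] ^ f s :: int poly) m = int (card {s \<in> S. f s = m})"
proof -
  have "coeff (\<Sum>s\<in>S. [:0, 1:] ^ f s :: int poly) m = (\<Sum>s\<in>S. of_bool (f s = m))"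
    by (auto simp: coeff_sum simp flip: monom_altdef [of 1, simplified] intro!: sum.cong)
  then show ?thesis using assms by (simp add: of_bool_def sum.If_cases Int_def)
qed

lemma X_mult_W: "fls_X * W kl ku = fps_to_fls (string_fps kl ku)"
proof (rule fls_eqI)
  fix n
  show "fls_nth (fls_X * W kl ku) n = fls_nth (fps_to_fls (string_fps kl ku)) n"
  proof (rule poly_eqI)
    fix m
    consider "n < 0" | "n = 0" | l where "n = int (Suc l)"
      by (metis not_less_iff_gr_or_eq zero_less_imp_eq_int gr0_implies_Suc)
    then show "coeff (fls_nth (fls_X * W kl ku) n) m =
        coeff (fls_nth (fps_to_fls (string_fps kl ku)) n) m"
    proof cases
      case 3
      then show ?thesis
        by (simp add: fls_X_times_conv_shift coeff_W w_def string_fps_def string_poly_def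
            coeff_sum_monom_power finite_strings nat_add_distrib)
    qed (auto simp: fls_X_times_conv_shift coeff_W w_def string_fps_def)
  qed
qed

section \<open>Laurent series and coefficients of the second variable\<close>

lemma fps_unit:
  fixes f :: "'a::comm_ring_1 fps"
  assumes "fps_nth f 0 = 1"
  shows "f dvd 1"
  by (rule dvdI[OF sym, OF fps_right_inverse[of f 1]]) (simp add: assms)

lemma fps_to_fls_unit:
  assumes "f dvd (1 :: 'a::comm_ring_1 fps)"
  shows "fps_to_fls f dvd 1"
proof -
  from assms obtain g where "1 = f * g" by (rule dvdE)
  then have "1 = fps_to_fls f * fps_to_fls g"
    by (simp flip: fls_times_fps_to_fls)
  then show ?thesis by (rule dvdI)
qed

lemma fls_X_unit: "(fls_X :: 'a::comm_ring_1 fls) dvd 1"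
proof
  show "1 = (fls_X :: 'a fls) * fls_X_inv"
    by (simp add: fls_X_times_conv_shift)
qed

lemma y_coeff_diff: "y_coeff m (F - G) = y_coeff m F - y_coeff m G"
  for F G :: "'a::comm_ring_1 poly fls"
  by (rule fls_eqI) (simp add: nth_y_coeff)

lemma y_coeff_add: "y_coeff m (F + G) = y_coeff m F + y_coeff m G"
  for F G :: "'a::comm_ring_1 poly fls"
  by (rule fls_eqI) (simp add: nth_y_coeff)

lemma y_coeff_X_mult: "y_coeff m (fls_X * F) = fls_X * y_coeff m F"
  for F :: "'a::comm_ring_1 poly fls"
  by (rule fls_eqI) (simp add: nth_y_coeff fls_X_times_conv_shift)

lemma y_coeff_X_power_mult: "y_coeff m (fls_X ^ k * F) = fls_X ^ k * y_coeff m F"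
  for F :: "'a::comm_ring_1 poly fls"
  by (induction k) (simp_all add: mult.assoc y_coeff_X_mult)

lemma y_coeff_Y_mult:
  "y_coeff m (fls_const [:0, 1:] * F) = (case m of 0 \<Rightarrow> 0 | Suc l \<Rightarrow> y_coeff l F)"
  for F :: "'a::comm_ring_1 poly fls"
  by (rule fls_eqI) (simp add: nth_y_coeff split: nat.split)

lemma y_coeff_one: "y_coeff m (1 :: 'a::comm_ring_1 poly fls) = of_bool (m = 0)"
  by (rule fls_eqI) (simp add: nth_y_coeff)

lemma y_coeff_X: "y_coeff m (fls_X :: 'a::comm_ring_1 poly fls) = of_bool (m = 0) * fls_X"
  using y_coeff_X_mult[of m 1] by (simp add: y_coeff_one mult.commute)

theorem mainTheorem4:
  fixes kl ku :: nat
  assumes "kl \<le> ku"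
  defines "X \<equiv> (fls_X :: int poly fls)"
    and "Y \<equiv> (fls_const [:0, 1:] :: int poly fls)"
    and "x \<equiv> (fls_X :: int fls)"
  shows "X * (1 - 2 * X + (1 - Y) * (X ^ (kl + 1) - X ^ (ku + 2))) dvd 1
       \<and> W kl ku = (1 - X) \<oslash> (X * (1 - 2 * X + (1 - Y) * (X ^ (kl + 1) - X ^ (ku + 2))))
       \<and> (\<forall>m::nat.
            x * (1 - 2 * x + x ^ (kl + 1) - x ^ (ku + 2)) ^ (m + 1) dvd 1
          \<and> y_coeff m (W kl ku) =
              ((1 - x) * (x ^ (kl + 1) - x ^ (ku + 2)) ^ m)
                \<oslash> (x * (1 - 2 * x + x ^ (kl + 1) - x ^ (ku + 2)) ^ (m + 1)))"
proof -
  define D where "D = 1 - 2 * X + (1 - Y) * (X ^ (kl + 1) - X ^ (ku + 2))"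
  define A where "A = 1 - 2 * x + x ^ (kl + 1) - x ^ (ku + 2)"
  define B where "B = x ^ (kl + 1) - x ^ (ku + 2)"
  define V where "V m = y_coeff m (W kl ku)" for m
  have D: "D = fps_to_fls (denominator kl ku)"
    by (simp add: D_def X_def Y_def denominator_def fls_times_fps_to_fls fps_to_fls_power
        fps_const_to_fls del: power_Suc)
  have "denominator kl ku dvd 1"
    by (rule fps_unit) (simp add: denominator_def)
  then have XD_unit: "X * D dvd 1"
    unfolding D X_def using fls_X_unit fps_to_fls_unit by (metis mult_dvd_mono mult_1)
  have WXD: "W kl ku * (X * D) = 1 - X"
  proof -
    have "W kl ku * (X * D) = fps_to_fls (string_fps kl ku * denominator kl ku)"
      by (simp add: D X_def fls_times_fps_to_fls flip: X_mult_W)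
    then show ?thesis
      unfolding string_fps_mult_denominator[OF assms(1)] by (simp add: X_def)
  qed
  have A: "A = fps_to_fls (1 - 2 * fps_X + fps_X ^ (kl + 1) - fps_X ^ (ku + 2))"
    by (simp add: A_def x_def fls_times_fps_to_fls fps_to_fls_power del: power_Suc)
  have "A dvd 1"
    unfolding A by (intro fps_to_fls_unit fps_unit) simp
  then have xA_unit: "x * A ^ (m + 1) dvd 1" for m
    unfolding x_def using fls_X_unit by (metis mult_dvd_mono mult_1 dvd_power_same power_one)
  \<comment> \<open>The coefficient of \<open>y\<^sup>m\<close> in \<open>W x (A - y B) = 1 - x\<close>.\<close>
  have rec: "x * (A * V m) = of_bool (m = 0) * (1 - x) + (case m of 0 \<Rightarrow> 0 | Suc l \<Rightarrow> x * (B * V l))"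
    for m
  proof -
    let ?W = "W kl ku"
    let ?B = "X ^ (kl + 1) * ?W - X ^ (ku + 2) * ?W"
    have "W kl ku * (X * D) = X * (?W - X * ?W - X * ?W + ?B - Y * ?B)"
      by (simp add: D_def algebra_simps)
    also have "y_coeff m \<dots> = x * (A * V m) - (case m of 0 \<Rightarrow> 0 | Suc l \<Rightarrow> x * (B * V l))"
      unfolding X_def Y_def x_def A_def B_def V_def
      by (simp only: y_coeff_diff y_coeff_add y_coeff_X_mult y_coeff_X_power_mult y_coeff_Y_mult)
        (simp add: algebra_simps split: nat.split)
    finally have "x * (A * V m) - (case m of 0 \<Rightarrow> 0 | Suc l \<Rightarrow> x * (B * V l)) = y_coeff m (1 - X)"
      using WXD by simp
    then show ?thesis
      by (simp add: X_def x_def y_coeff_diff y_coeff_one y_coeff_X algebra_simps)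
  qed
  have V: "V m * (x * A ^ (m + 1)) = (1 - x) * B ^ m" for m
  proof (induction m)
    case 0
    then show ?case using rec[of 0] by (simp add: mult_ac)
  next
    case (Suc m)
    have "V (Suc m) * (x * A ^ (Suc m + 1)) = x * (A * V (Suc m)) * A ^ (m + 1)"
      by (simp add: mult_ac)
    also have "\<dots> = B * (V m * (x * A ^ (m + 1)))"
      unfolding rec by (simp add: mult_ac)
    finally show ?case unfolding Suc.IH by (simp add: mult_ac)
  qed
  show ?thesis
    unfolding D_def[symmetric] A_def[symmetric] B_def[symmetric] V_def[symmetric]
      unit_quotient_eq_iff[OF XD_unit] unit_quotient_eq_iff[OF xA_unit]
    by (intro conjI allI XD_unit WXD xA_unit V)
qed

end
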